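(* Let $A\in\mathbb{R}^{n\times n}$, $B\in\mathbb{R}^{n\times m}$, let $U_0,U_0^\star\in\mathbb{R}^{m\times T}$ and $X_0,X_0^\star,X_1,X_1^\star\in\mathbb{R}^{n\times T}$ be the measured (unstarred) and accurate (starred) data matrices of the LTI system $x(k+1)=Ax(k)+Bu(k)$, so that $X_1^\star=\begin{bmatrix}B&A\end{bmatrix}\begin{bmatrix}U_0^\star\\ X_0^\star\end{bmatrix}$. Suppose that: (i) $\operatorname{rank}\begin{bmatrix}U_0\\ X_0\end{bmatrix}=m+n$; (ii) there are matrices $\delta_X,\delta_{UX}$ and real numbers $r_{X,1}$, $r_{UX,0}$ with $X_1^\star=X_1+\delta_X$, $\begin{bmatrix}U_0^\star\\ X_0^\star\end{bmatrix}=\begin{bmatrix}U_0\\ X_0\end{bmatrix}+\delta_{UX}$, and $$\frac{\|\delta_X\|}{\|X_1^\star\|}\le r_{X,1},\qquad \frac{\|\delta_{UX}\|}{\left\|\begin{bmatrix}U_0^\star\\ X_0^\star\end{bmatrix}\right\|}\le r_{UX,0}<1;$$ (iii) $\operatorname{rank}\begin{bmatrix}U_0^\star\\ X_0^\star\end{bmatrix}=m+n$, $\left\|\begin{bmatrix}U_0^\star\\ X_0^\star\end{bmatrix}\right\|<\infty$ and $\left\|\begin{bmatrix}U_0\\ X_0\end{bmatrix}\right\|<\infty$. Let $\begin{bmatrix}U_0\\ X_0\end{bmatrix}^\dagger_R$ be a right inverse of $\begin{bmatrix}U_0\\ X_0\end{bmatrix}$, let $\begin{bmatrix}B^e&A^e\end{bmatrix}:=X_1\begin{bmatrix}U_0\\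 X_0\end{bmatrix}^\dagger_R$, $\delta_{BA}:=\begin{bmatrix}B&A\end{bmatrix}-\begin{bmatrix}B^e&A^e\end{bmatrix}$, and $c_{UX}:=\left\|\begin{bmatrix}U_0\\ X_0\end{bmatrix}\right\|\left\|\begin{bmatrix}U_0\\ X_0\end{bmatrix}^\dagger_R\right\|$. Then $$\frac{\|\delta_{BA}\|}{\left\|\begin{bmatrix}B&A\end{bmatrix}\right\|}\le c_{UX}\,\frac{r_{X,1}+r_{UX,0}}{1-r_{UX,0}}.$$
   Context: $\|\cdot\|$ denotes the matrix $2$-norm (spectral norm). The LTI system is $x(k+1)=Ax(k)+Bu(k)$ with $x\in\mathbb{R}^n$, $u\in\mathbb{R}^m$. For a time horizon $T$, the measured (noisy) data matrices are $U_0=[u_d(0),\dots,u_d(T-1)]$, $X_0=[x_d(0),\dots,x_d(T-1)]$, $X_1=[x_d(1),\dots,x_d(T)]$, where $u_d(k),x_d(k)$ are the measured input and state at time $k$. The matrices $U_0^\star,X_0^\star,X_1^\star$ are built in the same way from the accurate (noise-free) inputs and states, which satisfy the system equation, so that $X_1^\star=\begin{bmatrix}B&A\end{bmatrix}\begin{bmatrix}U_0^\star\\ X_0^\star\end{bmatrix}$ and hence $\begin{bmatrix}B&A\end{bmatrix}=X_1^\star\begin{bmatrix}U_0^\star\\ X_0^\star\end{bmatrix}^\dagger_R$. The subscript $R$ on $\dagger$ denotes a right inverse: $MM^\dagger_R=I$. The quotients by norms presuppose nonzero denominators, i.e. $X_1^\star\neq0$. *)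

theory Defs
  imports "HOL-Analysis.Analysis"
begin

definition spectral_norm :: "real^'c^'r \<Rightarrow> real" where
  "spectral_norm M = onorm (\<lambda>v. M *v v)"

definition vstack :: "real^'c^'p \<Rightarrow> real^'c^'q \<Rightarrow> real^'c^('p + 'q)" where
  "vstack P Q = (\<chi> i. case i of Inl a \<Rightarrow> P $ a | Inr b \<Rightarrow> Q $ b)"

definition hstack :: "real^'p^'r \<Rightarrow> real^'q^'r \<Rightarrow> real^('p + 'q)^'r" where
  "hstack P Q = (\<chi> i j. case j of Inl a \<Rightarrow> P $ i $ a | Inr b \<Rightarrow> Q $ i $ b)"

text \<open>
  The time horizon \<open>T\<close> is the cardinality of a finite linearly ordered column index type \<open>'t\<close>;
  its elements, in increasing order, stand for the times \<open>0, \<dots>, T - 1\<close>.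
\<close>

definition time_of :: "'t::{finite,linorder} \<Rightarrow> nat" where
  "time_of j = card {i. i < j}"

text \<open>The matrix with columns \<open>w(s), \<dots>, w(s + T - 1)\<close>.\<close>

definition data_matrix :: "nat \<Rightarrow> (nat \<Rightarrow> real^'r) \<Rightarrow> real^('t::{finite,linorder})^'r" where
  "data_matrix s w = (\<chi> i j. w (s + time_of j) $ i)"

end

theory Submission
  imports Defs
begin

text \<open>
  Write \<open>G = [B A]\<close>, so that \<open>X1* = G W*\<close>. Since \<open>G = G W W_inv\<close>, the estimation error is
  \<open>(\<delta>X - G \<delta>UX) W_inv\<close>. Bound it by submultiplicativity and \<open>\<parallel>X1*\<parallel> \<le> \<parallel>G\<parallel> \<parallel>W*\<parallel>\<close>, then
  absorb \<open>\<parallel>W*\<parallel>\<close> using \<open>\<parallel>W*\<parallel> \<le> \<parallel>W\<parallel> + rUX0 \<parallel>W*\<parallel>\<close>.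
\<close>

lemma spectral_norm_nonneg: "0 \<le> spectral_norm M"
  unfolding spectral_norm_def by (rule onorm_pos_le) simp

text \<open>A matrix is determined by its action on vectors, so this reduces to positivity of
  \<open>onorm\<close>. It justifies the divisions by norms below.\<close>

lemma spectral_norm_pos_iff: "0 < spectral_norm M \<longleftrightarrow> M \<noteq> 0"
proof -
  have "(\<forall>v. M *v v = 0) \<longleftrightarrow> M = 0"
    by (metis matrix_eq matrix_vector_mult_0)
  then show ?thesis
    unfolding spectral_norm_def by (simp add: onorm_pos_lt)
qed

lemma spectral_norm_add: "spectral_norm (M + N) \<le> spectral_norm M + spectral_norm N"
  unfolding spectral_norm_def matrix_vector_mult_add_rdistrib
  by (rule onorm_triangle) simp_all

lemma spectral_norm_diff: "spectral_norm (M - N) \<le> spectral_norm M + spectral_norm N"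
  using onorm_triangle[of "(*v) M" "\<lambda>v. - (N *v v)"]
  by (simp add: spectral_norm_def matrix_vector_mult_diff_rdistrib onorm_neg bounded_linear_minus)

lemma spectral_norm_mult: "spectral_norm (M ** N) \<le> spectral_norm M * spectral_norm N"
  using onorm_compose[of "(*v) M" "(*v) N"]
  by (simp add: spectral_norm_def o_def matrix_vector_mul_assoc)

lemma matrix_mult_diff_rdistrib:
  fixes M N :: "real^'p^'q" and P :: "real^'r^'p"
  shows "(M - N) ** P = M ** P - N ** P"
  by (simp add: vec_eq_iff matrix_matrix_mult_def left_diff_distrib sum_subtractf)

text \<open>The sum over the inner sum type splits along \<open>Inl\<close> and \<open>Inr\<close>;
  reversing \<open>UNIV_Plus_UNIV\<close> exposes the disjoint union to
  \<open>sum.Plus\<close>.\<close>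

lemma hstack_mult_vstack: "hstack P Q ** vstack R S = P ** R + Q ** S"
  by (simp add: vec_eq_iff matrix_matrix_mult_def hstack_def vstack_def
      UNIV_Plus_UNIV[symmetric] sum.Plus del: UNIV_Plus_UNIV)

lemma mult_data_matrix: "M ** data_matrix s w = data_matrix s (\<lambda>k. M *v w k)"
  by (simp add: vec_eq_iff data_matrix_def matrix_matrix_mult_def matrix_vector_mult_def)

lemma time_of_less_card: "time_of (j :: 't::{finite,linorder}) < CARD('t)"
  \<comment> \<open>The inclusion in the universe is strict because \<open>j\<close> is not below
    itself.\<close>
  unfolding time_of_def by (rule psubset_card_mono) auto

lemma data_matrix_system:
  fixes x :: "nat \<Rightarrow> real^'n" and u :: "nat \<Rightarrow> real^'m"
  assumes "\<And>k. k < CARD('t) \<Longrightarrow> x (k + 1) = A *v x k + B *v u k"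
  shows "(data_matrix 1 x :: real^('t::{finite,linorder})^'n) = hstack B A ** vstack (data_matrix 0 u) (data_matrix 0 x)"
  unfolding hstack_mult_vstack mult_data_matrix
  \<comment> \<open>Column \<open>j\<close> is the system equation at \<open>k = time_of j\<close>;
    only times below the horizon occur.\<close>
  using assms[OF time_of_less_card]
  by (simp add: vec_eq_iff data_matrix_def add.commute)

text \<open>Isolates the estimate from the block structure and the dynamics, which enter only
  through \<open>X' = G ** W'\<close>.\<close>

lemma right_inverse_perturbation:
  fixes G :: "real^'p^'n" and W W' E :: "real^'t^'p" and X X' D :: "real^'t^'n"
  assumes exact: "X' = G ** W'" and nonzero: "X' \<noteq> 0"
    and noise: "X' = X + D" "W' = W + E"
    and D: "spectral_norm D / spectral_norm X' \<le> r"
    and E: "spectral_norm E / spectral_norm W' \<le> s" and s: "s < 1"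
    and right_inverse: "W ** V = mat 1"
  shows "spectral_norm (G - X ** V) / spectral_norm G
    \<le> (spectral_norm W * spectral_norm V) * ((r + s) / (1 - s))"
proof -
  \<comment> \<open>A nonzero product has nonzero factors, so all three denominators are
    positive.\<close>
  have "G \<noteq> 0" "W' \<noteq> 0"
    using exact nonzero by (auto simp: matrix_matrix_mult_def zero_vec_def)
  with nonzero have G: "0 < spectral_norm G" and W': "0 < spectral_norm W'"
    and X': "0 < spectral_norm X'"
    by (simp_all add: spectral_norm_pos_iff)
  \<comment> \<open>Both numbers dominate a quotient of norms.\<close>
  have "0 \<le> r" "0 \<le> s"
    using D E by (auto intro: order_trans[rotated] simp: spectral_norm_nonneg)
  have "G - X ** V = G ** (W ** V) - X ** V"
    by (simp add: right_inverse)
  also have "\<dots> = (G ** W - X) ** V"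
    by (simp add: matrix_mul_assoc matrix_mult_diff_rdistrib)
  \<comment> \<open>Substitute \<open>W = W' - E\<close> and \<open>X = X' - D\<close>; the exact
    terms \<open>G ** W'\<close> and \<open>X'\<close> cancel.\<close>
  also have "G ** W - X = D - G ** E"
    using exact noise by (simp add: matrix_add_ldistrib algebra_simps)
  finally have error: "G - X ** V = (D - G ** E) ** V" .
  have "spectral_norm D \<le> r * spectral_norm X'"
    using D X' by (simp add: divide_simps)
  \<comment> \<open>Trading \<open>X'\<close> for \<open>G\<close> and \<open>W'\<close> gives both
    error terms the common factor \<open>spectral_norm G\<close>, which the relative error divides
    out.\<close>
  also have "\<dots> \<le> r * (spectral_norm G * spectral_norm W')"
    unfolding exact using \<open>0 \<le> r\<close> by (intro mult_left_mono spectral_norm_mult)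
  finally have D_le: "spectral_norm D \<le> r * (spectral_norm G * spectral_norm W')" .
  have E_le: "spectral_norm E \<le> s * spectral_norm W'"
    using E W' by (simp add: divide_simps)
  have "spectral_norm (G ** E) \<le> spectral_norm G * (s * spectral_norm W')"
    using spectral_norm_mult mult_left_mono[OF E_le spectral_norm_nonneg] by (rule order_trans)
  then have DGE: "spectral_norm (D - G ** E) \<le> (r + s) * spectral_norm W' * spectral_norm G"
    using D_le spectral_norm_diff[of D "G ** E"] by (simp add: algebra_simps)
  \<comment> \<open>Passes from accurate to measured data: moving the last term to the left leaves
    the factor \<open>1 - s\<close>, positive by \<open>s < 1\<close>.\<close>
  have "spectral_norm W' \<le> spectral_norm W + s * spectral_norm W'"
    using spectral_norm_add[of W E] E_le noise(2) by simp
  then have W'_le: "spectral_norm W' \<le> spectral_norm W / (1 - s)"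
    using s by (simp add: field_simps)
  have "spectral_norm (G - X ** V) \<le> (r + s) * spectral_norm W' * spectral_norm G * spectral_norm V"
    unfolding error
    using spectral_norm_mult mult_right_mono[OF DGE spectral_norm_nonneg] by (rule order_trans)
  then have "spectral_norm (G - X ** V) / spectral_norm G
      \<le> (r + s) * spectral_norm W' * spectral_norm V"
    using G by (simp add: field_simps)
  also have "\<dots> \<le> (r + s) * (spectral_norm W / (1 - s)) * spectral_norm V"
    using \<open>0 \<le> r\<close> \<open>0 \<le> s\<close>
    by (intro mult_right_mono mult_left_mono W'_le spectral_norm_nonneg) simp
  finally show ?thesis
    by (simp add: mult_ac)
qed

theorem mainTheorem1:
  fixes A :: "real^'n^'n" and B :: "real^'m^'n"
    and u u_star :: "nat \<Rightarrow> real^'m" and x x_star :: "nat \<Rightarrow> real^'n"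
    and U0 U0_star :: "real^('t::{finite,linorder})^'m"
    and X0 X0_star X1 X1_star \<delta>X :: "real^('t::{finite,linorder})^'n"
    and W W_star \<delta>UX :: "real^('t::{finite,linorder})^('m + 'n)"
    and W_inv :: "real^('m + 'n)^('t::{finite,linorder})"
    and Ae :: "real^'n^'n" and Be :: "real^'m^'n"
    and \<delta>BA :: "real^('m + 'n)^'n"
    and rX1 rUX0 cUX :: real
  assumes measured: "U0 = data_matrix 0 u" "X0 = data_matrix 0 x" "X1 = data_matrix 1 x"
    and accurate: "U0_star = data_matrix 0 u_star" "X0_star = data_matrix 0 x_star"
      "X1_star = data_matrix 1 x_star"
    and system: "\<And>k. k < CARD('t) \<Longrightarrow> x_star (k + 1) = A *v x_star k + B *v u_star k"
    and W: "W = vstack U0 X0" and W_star: "W_star = vstack U0_star X0_star"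
    and X1_star_nonzero: "X1_star \<noteq> 0"
    and rank_W: "rank W = CARD('m) + CARD('n)"
    and noise_X: "X1_star = X1 + \<delta>X" and noise_UX: "W_star = W + \<delta>UX"
    and bound_X: "spectral_norm \<delta>X / spectral_norm X1_star \<le> rX1"
    and bound_UX: "spectral_norm \<delta>UX / spectral_norm W_star \<le> rUX0" "rUX0 < 1"
    and rank_W_star: "rank W_star = CARD('m) + CARD('n)"
    and finite_norms: "ereal (spectral_norm W_star) < \<infinity>" "ereal (spectral_norm W) < \<infinity>"
    and right_inverse: "W ** W_inv = mat 1"
    and estimate: "hstack Be Ae = X1 ** W_inv"
    and error: "\<delta>BA = hstack B A - hstack Be Ae"
    and condition_number: "cUX = spectral_norm W * spectral_norm W_inv"
  shows "spectral_norm \<delta>BA / spectral_norm (hstack B A) \<le> cUX * ((rX1 + rUX0) / (1 - rUX0))"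
proof -
  have "X1_star = hstack B A ** W_star"
    unfolding W_star accurate by (rule data_matrix_system) (rule system)
  from right_inverse_perturbation[OF this X1_star_nonzero noise_X noise_UX bound_X bound_UX
      right_inverse]
  show ?thesis
    unfolding error estimate condition_number .
qed

end
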